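(* Let $D$ be an odd positive nonsquare integer such that the equation $x^2-Dy^2=4$ is solvable in odd integers $x,y$, and let $\varepsilon=x_1+y_1\sqrt{D}$ be the minimal positive solution of $x^2-Dy^2=4$. Let $(x,y)$ be a positive integer solution of $x^2-Dy^2=4$ with $y=p_1^{n_1}p_2^{n_2}y'$, where $p_1,p_2$ are primes not dividing $D$, $n_1,n_2$ are positive integers and $y'$ is a positive integer. If every prime divisor of $y'$ divides $D$, then $\frac{x+y\sqrt{D}}{2}$ equals one of $$\frac{\varepsilon}{2},\ \left(\frac{\varepsilon}{2}\right)^2,\ \left(\frac{\varepsilon}{2}\right)^3,\ \left(\frac{\varepsilon}{2}\right)^4,\ \left(\frac{\varepsilon}{2}\right)^6,\ \left(\frac{\varepsilon}{2}\right)^q,$$ where $q$ is an odd prime with $\gcd(q,p_1p_2)=1$.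
   Context: The minimal positive solution of $x^2-Dy^2=4$ is the solution $(x_1,y_1)$ in positive integers for which $x_1+y_1\sqrt{D}$ is smallest. *)

theory Defs
  imports Complex_Main "HOL-Computational_Algebra.Nth_Powers"
begin

definition pell4_pos_solution :: "int \<Rightarrow> int \<Rightarrow> int \<Rightarrow> bool" where
  "pell4_pos_solution D x y \<longleftrightarrow> x > 0 \<and> y > 0 \<and> x\<^sup>2 - D * y\<^sup>2 = 4"

definition pell4_value :: "int \<Rightarrow> int \<Rightarrow> int \<Rightarrow> real" where
  "pell4_value D x y = of_int x + of_int y * sqrt (of_int D)"

definition pell4_minimal_solution :: "int \<Rightarrow> int \<Rightarrow> int \<Rightarrow> bool" where
  "pell4_minimal_solution D x\<^sub>1 y\<^sub>1 \<longleftrightarrow>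
     pell4_pos_solution D x\<^sub>1 y\<^sub>1 \<and>
     (\<forall>x y. pell4_pos_solution D x y \<longrightarrow> pell4_value D x\<^sub>1 y\<^sub>1 \<le> pell4_value D x y)"

end

theory Submission
  imports Defs "HOL-Number_Theory.Residues"
begin

text \<open>
  Every positive solution is $(V_n(x_1),\, y_1 U_n(x_1))$ for some $n \ge 1$, with $U_n, V_n$ the Lucas
  sequences of parameters $(x_1, 1)$. For $n = 2k + 1$ one has
  $U_n = (U_{k+1} + U_k)(U_{k+1} - U_k)$; for a prime $r = n \ge 5$ each factor is divisible by $r$
  at most once and exceeds $r$ (apart from small $x_1$), so $U_r(X)$ has two distinct prime divisors
  different from $r$ and prime to $X^2 - 4$. With $U_{qr}(X) = U_q(X)\, U_r(V_q(X))$ this yields three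
  primes not dividing $D$ in $y$ for every composite index outside $\{1, 2, 3, 4, 6\}$, the indices
  divisible by $8$, $9$ or $12$ being handled by explicit factorizations. If $n = q \ge 5$ is
  prime and $q \in \{p_1, p_2\}$, then $q$ divides $y_1$, so $x_1$ is large and
  $U_q$ supplies two further primes besides $q$, which is one too many.
\<close>

section \<open>Lucas sequences\<close>

text \<open>With a + b = X and a b = 1, U_n is (a^n - b^n) / (a - b) and V_n, below, is a^n + b^n.
  The recurrences keep everything in the integers and also cover X = 2, where a = b. These roots a,
  b are used in the explanations that follow.\<close>

fun lucas_U :: "int \<Rightarrow> nat \<Rightarrow> int" where
  "lucas_U X 0 = 0"
| "lucas_U X (Suc 0) = 1"
| "lucas_U X (Suc (Suc n)) = X * lucas_U X (Suc n) - lucas_U X n"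

fun lucas_V :: "int \<Rightarrow> nat \<Rightarrow> int" where
  "lucas_V X 0 = 2"
| "lucas_V X (Suc 0) = X"
| "lucas_V X (Suc (Suc n)) = X * lucas_V X (Suc n) - lucas_V X n"

text \<open>This is V_n = U_(n+1) - U_(n-1) with U_(n-1) eliminated by the recurrence, so that no
  predecessor index occurs. It reduces facts about V to the pair of consecutive terms of U.\<close>

lemma lucas_V_eq_U: "lucas_V X n = 2 * lucas_U X (Suc n) - X * lucas_U X n"
proof (induction X n rule: lucas_V.induct)
  case (3 X n)
  have "lucas_V X (Suc (Suc n))
      = X * (2 * lucas_U X (Suc (Suc n)) - X * lucas_U X (Suc n))
        - (2 * lucas_U X (Suc n) - X * lucas_U X n)"
    by (simp only: lucas_V.simps 3)
  also have "\<dots> = 2 * lucas_U X (Suc (Suc (Suc n))) - X * lucas_U X (Suc (Suc n))"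
    by (simp add: algebra_simps)
  finally show ?case .
qed auto

text \<open>The left side is (U_(n+1) - b U_n)(U_(n+1) - a U_n) = a^n b^n. In particular consecutive
  terms of U are coprime.\<close>

lemma lucas_U_norm:
  "(lucas_U X (Suc n))\<^sup>2 - X * lucas_U X (Suc n) * lucas_U X n + (lucas_U X n)\<^sup>2 = 1"
  by (induction n) (auto simp: algebra_simps power2_eq_square)

lemma lucas_V_square: "(lucas_V X n)\<^sup>2 - 4 = (X\<^sup>2 - 4) * (lucas_U X n)\<^sup>2"
proof -
  have "(lucas_V X n)\<^sup>2 - 4 - (X\<^sup>2 - 4) * (lucas_U X n)\<^sup>2
      = 4 * ((lucas_U X (Suc n))\<^sup>2 - X * lucas_U X (Suc n) * lucas_U X n + (lucas_U X n)\<^sup>2 - 1)"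
    unfolding lucas_V_eq_U by (simp add: algebra_simps power2_eq_square)
  then show ?thesis by (simp add: lucas_U_norm)
qed

section \<open>Shifting and multiplying the index\<close>

lemma lucas_U_add:
  "lucas_U X (m + Suc n) = lucas_U X (Suc m) * lucas_U X (Suc n) - lucas_U X m * lucas_U X n"
proof (induction n arbitrary: m)
  case (Suc n)
  show ?case using Suc[of "Suc m"] by (simp add: algebra_simps)
qed auto

text \<open>The numbers a^m and b^m are the roots of t^2 - V_m t + 1, so sampling any solution of
  the recurrence at steps of m gives a solution with parameter V_m. A general \<open>w\<close> is
  allowed because both U and V are needed later.\<close>

lemma lucas_recurrence_step:
  fixes w :: "nat \<Rightarrow> int"
  assumes rec: "\<And>n. w (Suc (Suc n)) = X * w (Suc n) - w n"
  shows "w (n + 2 * m) = lucas_V X m * w (n + m) - w n"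
proof (induction m arbitrary: n rule: induct_nat_012)
  case (ge2 m)
  have "w (n + 2 * Suc (Suc m))
      = X * w (Suc n + 2 * Suc m) - w (Suc (Suc n) + 2 * m)"
    using rec[of "n + 2 * Suc m"] by (simp add: algebra_simps)
  also have "\<dots> = X * (lucas_V X (Suc m) * w (n + Suc (Suc m)) - w (Suc n))
      - (lucas_V X m * w (n + Suc (Suc m)) - w (Suc (Suc n)))"
    unfolding ge2 by simp
  also have "\<dots> = lucas_V X (Suc (Suc m)) * w (n + Suc (Suc m)) - w n"
    using rec[of n] by (simp add: algebra_simps)
  finally show ?case .
qed (use rec in auto)

lemma lucas_U_mult: "lucas_U X (m * n) = lucas_U X m * lucas_U (lucas_V X m) n"
proof (induction n rule: induct_nat_012)
  case (ge2 n)
  have "lucas_U X (m * n + 2 * m) = lucas_V X m * lucas_U X (m * n + m) - lucas_U X (m * n)"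
    by (rule lucas_recurrence_step) simp
  moreover have "m * n + 2 * m = m * Suc (Suc n)" "m * n + m = m * Suc n" by simp_all
  ultimately have "lucas_U X (m * Suc (Suc n)) = lucas_V X m * lucas_U X (m * Suc n) - lucas_U X (m * n)"
    by metis
  then show ?case unfolding ge2 by (simp add: algebra_simps)
qed auto

lemma lucas_U_dvd: "m dvd n \<Longrightarrow> lucas_U X m dvd lucas_U X n"
  by (auto elim!: dvdE simp: lucas_U_mult)

lemma lucas_U_odd_index:
  "lucas_U X (2 * k + 1)
     = (lucas_U X (Suc k) + lucas_U X k) * (lucas_U X (Suc k) - lucas_U X k)"
proof -
  have "2 * k + 1 = k + Suc k" by simp
  then show ?thesis by (simp only: lucas_U_add) (simp add: algebra_simps)
qed

text \<open>Put a = c^2 and n = 2k + 1. Then V_n - 2 = (c^n - c^(-n))^2 and X - 2 = (c - 1/c)^2,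
  while U_(k+1) + U_k is the quotient (c^n - c^(-n)) / (c - 1/c).\<close>

lemma lucas_V_odd_index_minus:
  "lucas_V X (2 * k + 1) - 2 = (X - 2) * (lucas_U X (Suc k) + lucas_U X k)\<^sup>2"
proof -
  have "Suc (2 * k + 1) = Suc k + Suc k" by simp
  then have even: "lucas_U X (Suc (2 * k + 1))
      = (X * lucas_U X (Suc k) - lucas_U X k) * lucas_U X (Suc k) - lucas_U X (Suc k) * lucas_U X k"
    by (simp only: lucas_U_add lucas_U.simps(3))
  have "lucas_V X (2 * k + 1) - 2 - (X - 2) * (lucas_U X (Suc k) + lucas_U X k)\<^sup>2
      = 2 * ((lucas_U X (Suc k))\<^sup>2 - X * lucas_U X (Suc k) * lucas_U X k + (lucas_U X k)\<^sup>2 - 1)"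
    unfolding lucas_V_eq_U even lucas_U_odd_index by (simp add: algebra_simps power2_eq_square)
  then show ?thesis by (simp add: lucas_U_norm)
qed

section \<open>Congruences modulo a prime index\<close>

text \<open>Since 1 + a^2 = a (a + b) = a X, the binomial theorem expands (a X)^r = (1 + a^2)^r.
  Multiplying by a^n and adding the same identity for b gives the claim; the induction replays this
  through Pascal's rule.\<close>

lemma lucas_V_binomial:
  "(\<Sum>j\<le>r. int (r choose j) * lucas_V X (n + 2 * j)) = X ^ r * lucas_V X (n + r)"
proof (induction r arbitrary: n)
  case (Suc r)
  have "(\<Sum>j\<le>Suc r. int (Suc r choose j) * lucas_V X (n + 2 * j))
      = lucas_V X n + (\<Sum>j\<le>r. int (Suc r choose Suc j) * lucas_V X (n + 2 * Suc j))"
    by (subst sum.atMost_Suc_shift) simp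
  also have "\<dots> = lucas_V X n + (\<Sum>j\<le>r. int (r choose Suc j) * lucas_V X (n + 2 * Suc j))
      + (\<Sum>j\<le>r. int (r choose j) * lucas_V X (n + 2 * Suc j))"
    by (simp only: binomial_Suc_Suc of_nat_add distrib_right sum.distrib add_ac)
  also have "lucas_V X n + (\<Sum>j\<le>r. int (r choose Suc j) * lucas_V X (n + 2 * Suc j))
      = (\<Sum>j\<le>Suc r. int (r choose j) * lucas_V X (n + 2 * j))"
    by (subst sum.atMost_Suc_shift) simp
  also have "\<dots> = (\<Sum>j\<le>r. int (r choose j) * lucas_V X (n + 2 * j))"
    by simp
  also have "\<dots> + (\<Sum>j\<le>r. int (r choose j) * lucas_V X (n + 2 * Suc j))
      = X * (\<Sum>j\<le>r. int (r choose j) * lucas_V X (Suc n + 2 * j))"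
    unfolding sum_distrib_left sum.distrib[symmetric]
    by (rule sum.cong) (auto simp: algebra_simps)
  also have "\<dots> = X ^ Suc r * lucas_V X (n + Suc r)"
    using Suc[of "Suc n"] by simp
  finally show ?case .
qed simp

text \<open>Modulo r only the terms j = 0 and j = r of the binomial identity survive, and V_0 +
  V_(2r) = V_r^2.\<close>

lemma lucas_V_prime_cong:
  assumes "prime r"
  shows "[X ^ r * lucas_V X r = (lucas_V X r)\<^sup>2] (mod int r)"
proof -
  have "r > 0" using assms by (simp add: prime_gt_0_nat)
  have "X ^ r * lucas_V X r = (\<Sum>j\<le>r. int (r choose j) * lucas_V X (2 * j))"
    using lucas_V_binomial[of r X 0] by simp
  also have "\<dots> = (\<Sum>j\<in>{0, r}. int (r choose j) * lucas_V X (2 * j))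
      + (\<Sum>j\<in>{..r} - {0, r}. int (r choose j) * lucas_V X (2 * j))"
    by (subst sum.subset_diff[of "{0, r}"]) auto
  also have "(\<Sum>j\<in>{0, r}. int (r choose j) * lucas_V X (2 * j)) = (lucas_V X r)\<^sup>2"
    using \<open>r > 0\<close> lucas_recurrence_step[of "lucas_V X" X 0 r] by (simp add: power2_eq_square)
  finally have "X ^ r * lucas_V X r - (lucas_V X r)\<^sup>2
      = (\<Sum>j\<in>{..r} - {0, r}. int (r choose j) * lucas_V X (2 * j))" by simp
  moreover have "int r dvd (\<Sum>j\<in>{..r} - {0, r}. int (r choose j) * lucas_V X (2 * j))"
    by (intro dvd_sum dvd_mult2) (use assms in \<open>auto intro!: dvd_choose_prime\<close>)
  ultimately show ?thesis by (simp add: cong_iff_dvd_diff)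
qed

lemma fermat_int:
  assumes "prime r"
  shows "[X ^ r = X] (mod int r)"
proof (cases "int r dvd X")
  case True
  then have "int r dvd X ^ r" using assms prime_gt_0_nat by (simp add: dvd_power_same dvd_trans dvd_power)
  then show ?thesis using True by (simp add: cong_iff_dvd_diff)
next
  case False
  have pos: "int r > 0" using assms prime_gt_0_nat by simp
  define a where "a = nat (X mod int r)"
  have a: "int a = X mod int r" using pos by (simp add: a_def)
  have "\<not> r dvd a" using False a by (metis dvd_mod_iff dvd_refl int_dvd_int_iff)
  then have "[a ^ (r - 1) = 1] (mod r)" using assms fermat_theorem by blast
  then have "[int a ^ (r - 1) = 1] (mod int r)" by (metis cong_int_iff of_nat_1 of_nat_power)
  then have "[int a * int a ^ (r - 1) = int a * 1] (mod int r)" by (rule cong_scalar_left)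
  then have "[int a ^ r = int a] (mod int r)"
    using pos by (metis mult.right_neutral of_nat_0_less_iff power_eq_if less_numeral_extra(3))
  moreover have "[int a = X] (mod int r)" unfolding a cong_def by simp
  ultimately show ?thesis by (meson cong_pow cong_sym cong_trans)
qed

text \<open>By \<open>lucas_V_odd_index_minus\<close> the hypothesis forces V_r = 2 mod r. With
  Fermat's little theorem, \<open>lucas_V_prime_cong\<close> then reads 2 X = 4 mod r, and r is
  odd.\<close>

lemma prime_dvd_half_imp_dvd:
  assumes "prime r" "r = 2 * k + 1" "int r dvd lucas_U X (Suc k) + lucas_U X k"
  shows "int r dvd X - 2"
proof -
  have "int r dvd lucas_V X r - 2"
    using lucas_V_odd_index_minus[of X k] assms by (simp add: power2_eq_square)
  then have V: "[lucas_V X r = 2] (mod int r)" by (simp add: cong_iff_dvd_diff)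
  have "[X * 2 = X ^ r * lucas_V X r] (mod int r)"
    using fermat_int[OF assms(1)] V by (meson cong_mult cong_sym)
  also have "[X ^ r * lucas_V X r = (lucas_V X r)\<^sup>2] (mod int r)"
    by (rule lucas_V_prime_cong) fact
  also have "[(lucas_V X r)\<^sup>2 = 2\<^sup>2] (mod int r)"
    using V by (rule cong_pow)
  finally have "int r dvd (X - 2) * 2" by (simp add: cong_iff_dvd_diff algebra_simps)
  moreover have "coprime (int r) 2" using assms(2) by simp
  ultimately show ?thesis using coprime_dvd_mult_left_iff by blast
qed

text \<open>First-order Taylor expansion in X at X = 2, where U_n takes the value n and has
  derivative (n^3 - n) / 6; the factor 6 clears the denominator.\<close>

lemma lucas_U_taylor:
  "\<exists>c. 6 * lucas_U X n = 6 * int n + (X - 2) * (int n ^ 3 - int n) + (X - 2)\<^sup>2 * c"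
proof (induction n rule: induct_nat_012)
  case (ge2 n)
  then obtain c d where
    c: "6 * lucas_U X n = 6 * int n + (X - 2) * (int n ^ 3 - int n) + (X - 2)\<^sup>2 * c" and
    d: "6 * lucas_U X (Suc n)
      = 6 * int (Suc n) + (X - 2) * (int (Suc n) ^ 3 - int (Suc n)) + (X - 2)\<^sup>2 * d"
    by blast
  have "6 * lucas_U X (Suc (Suc n)) = X * (6 * lucas_U X (Suc n)) - 6 * lucas_U X n"
    by simp
  \<comment> \<open>The new remainder is X d - c together with the linear coefficient at n + 1,
    which acquires a second factor X - 2 when X is written as 2 + (X - 2).\<close>
  also have "\<dots> = 6 * int (Suc (Suc n)) + (X - 2) * (int (Suc (Suc n)) ^ 3 - int (Suc (Suc n)))
      + (X - 2)\<^sup>2 * (int (Suc n) ^ 3 - int (Suc n) + X * d - c)"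
    unfolding c d by (simp add: algebra_simps power2_eq_square power3_eq_cube)
  finally show ?case by blast
next
  case 1
  show ?case by (auto intro: exI[of _ 0])
qed (auto intro: exI[of _ 0])

lemma lucas_U_cong_index: "X - 2 dvd lucas_U X n - int n"
proof (induction n rule: induct_nat_012)
  case (ge2 n)
  have "lucas_U X (Suc (Suc n)) - int (Suc (Suc n))
      = X * (lucas_U X (Suc n) - int (Suc n)) - (lucas_U X n - int n) + (X - 2) * int (Suc n)"
    by (simp add: algebra_simps)
  then show ?case using ge2 by (metis dvd_add dvd_diff dvd_mult dvd_triv_left)
qed auto

text \<open>Adding the expansions at k and k + 1, the linear coefficients combine to k (k + 1) r. As
  r divides X - 2, six times the factor is 6 r modulo r^2, and r does not divide 6.\<close>

lemma prime_square_not_dvd_half: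
  assumes "prime r" "r = 2 * k + 1" "r \<ge> 5" "int r dvd lucas_U X (Suc k) + lucas_U X k"
  shows "\<not> (int r)\<^sup>2 dvd lucas_U X (Suc k) + lucas_U X k"
proof
  assume sq: "(int r)\<^sup>2 dvd lucas_U X (Suc k) + lucas_U X k"
  obtain c d where
    c: "6 * lucas_U X k = 6 * int k + (X - 2) * (int k ^ 3 - int k) + (X - 2)\<^sup>2 * c" and
    d: "6 * lucas_U X (Suc k)
      = 6 * int (Suc k) + (X - 2) * (int (Suc k) ^ 3 - int (Suc k)) + (X - 2)\<^sup>2 * d"
    using lucas_U_taylor by blast
  obtain z where z: "X - 2 = int r * z"
    using prime_dvd_half_imp_dvd[OF assms(1,2,4)] by blast
  have "6 * (lucas_U X (Suc k) + lucas_U X k)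
      = 6 * int r + (X - 2) * (int k * (int k + 1) * int r) + (X - 2)\<^sup>2 * (c + d)"
    using c d assms(2) by (simp add: algebra_simps power3_eq_cube)
  also have "\<dots> = 6 * int r + (int r)\<^sup>2 * (z * int k * (int k + 1) + z\<^sup>2 * (c + d))"
    unfolding z by (simp add: algebra_simps power2_eq_square)
  finally obtain w where w: "6 * (lucas_U X (Suc k) + lucas_U X k) = 6 * int r + (int r)\<^sup>2 * w"
    by blast
  have "(int r)\<^sup>2 dvd 6 * int r + (int r)\<^sup>2 * w"
    using sq unfolding w[symmetric] by (rule dvd_mult)
  then have "(int r)\<^sup>2 dvd 6 * int r" by (simp add: dvd_add_left_iff)
  then have "int r dvd 6" using assms(3) by (simp add: power2_eq_square)
  then have "r dvd 6" by presburger
  then have "r \<le> 6" by (auto dest: dvd_imp_le)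
  then have "r = 5 \<or> r = 6" using assms(3) by auto
  moreover have "r \<noteq> 6" using assms(2) by presburger
  ultimately have "r = 5" by simp
  with \<open>r dvd 6\<close> show False by simp
qed

section \<open>Prime divisors of U_r prime to the discriminant X^2 - 4\<close>

lemma prime_divisor_other:
  fixes a r :: int
  assumes "prime r" "\<bar>a\<bar> > r" "\<not> r\<^sup>2 dvd a"
  shows "\<exists>s. prime s \<and> s dvd a \<and> s \<noteq> r"
proof (cases "r dvd a")
  case True
  then obtain c where c: "a = r * c" by blast
  have "\<not> r dvd c" using assms(3) c by (auto simp: power2_eq_square)
  have "r > 0" using assms(1) prime_gt_0_int by blast
  have "\<not> is_unit c" "c \<noteq> 0"
    using assms(2) c \<open>r > 0\<close> by (auto simp: abs_mult)
  then obtain s where "prime s" "s dvd c" using prime_divisor_exists by blast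
  then show ?thesis using c \<open>\<not> r dvd c\<close> by auto
next
  case False
  have "r > 1" using assms(1) prime_gt_1_int by blast
  have "\<not> is_unit a" "a \<noteq> 0" using assms(2) \<open>r > 1\<close> by auto
  then obtain s where "prime s" "s dvd a" using prime_divisor_exists by blast
  then show ?thesis using False by auto
qed

lemma half_prime_divisor:
  assumes "prime r" "r = 2 * k + 1" "r \<ge> 5" "\<bar>lucas_U X (Suc k) + lucas_U X k\<bar> > int r"
  shows "\<exists>s. prime s \<and> s dvd lucas_U X (Suc k) + lucas_U X k \<and> s \<noteq> int r \<and> \<not> s dvd X\<^sup>2 - 4"
proof -
  let ?a = "lucas_U X (Suc k) + lucas_U X k"
  have "\<not> (int r)\<^sup>2 dvd ?a"
    using prime_square_not_dvd_half[OF assms(1-3)] by (metis dvd_trans dvd_triv_left power2_eq_square)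
  then obtain s where s: "prime s" "s dvd ?a" "s \<noteq> int r"
    using prime_divisor_other[of "int r" ?a] assms(1,4) by auto
  \<comment> \<open>Modulo X - 2 the factor is (k + 1) + k = r, so s would divide r.\<close>
  have "\<not> s dvd X - 2"
  proof
    assume *: "s dvd X - 2"
    have "X - 2 dvd (lucas_U X (Suc k) - int (Suc k)) + (lucas_U X k - int k)"
      by (intro dvd_add lucas_U_cong_index)
    then have "s dvd ?a - int r" using * assms(2) by (auto simp: algebra_simps intro: dvd_trans)
    then have "s dvd int r" using s(2) by (metis dvd_diff_right_iff diff_diff_eq2 dvd_diffD1)
    then show False using s assms(1) by (metis prime_nat_int_transfer primes_dvd_imp_eq)
  qed
  \<comment> \<open>By the norm identity the square of the factor is 1 modulo X + 2.\<close>
  moreover have "\<not> s dvd X + 2"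
  proof
    assume *: "s dvd X + 2"
    have "?a\<^sup>2 - (X + 2) * (lucas_U X (Suc k) * lucas_U X k) = 1"
      using lucas_U_norm[of X k] by (simp add: algebra_simps power2_eq_square)
    moreover have "s dvd ?a\<^sup>2 - (X + 2) * (lucas_U X (Suc k) * lucas_U X k)"
      using * s(2) by (simp add: power2_eq_square)
    ultimately show False using s(1) not_prime_unit by metis
  qed
  moreover have "X\<^sup>2 - 4 = (X - 2) * (X + 2)" by (simp add: algebra_simps power2_eq_square)
  ultimately show ?thesis using s by (auto simp: prime_dvd_mult_iff)
qed

text \<open>Replacing X by -X turns U_(k+1) + U_k into U_(k+1) - U_k up to sign, so facts about one
  factor of U_(2k+1) carry over to the other.\<close>

lemma lucas_U_uminus: "lucas_U (- X) n = (if even n then - lucas_U X n else lucas_U X n)"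
  by (induction n rule: induct_nat_012) auto

lemma even_lucas_U_iff:
  "even (lucas_U X n) \<longleftrightarrow> (if even X then n mod 2 = 0 else n mod 3 = 0)"
proof (induction n rule: induct_nat_012)
  case (ge2 n)
  have "even (lucas_U X (Suc (Suc n)))
      \<longleftrightarrow> (even X \<or> even (lucas_U X (Suc n))) = even (lucas_U X n)" by auto
  then show ?case using ge2 by (cases "even X"; simp only: if_True if_False; presburger)
qed auto

lemma lucas_U_growth:
  assumes "X \<ge> 3"
  shows "int n \<le> lucas_U X n \<and> (X - 1) * lucas_U X n \<le> lucas_U X (Suc n)"
proof (induction n)
  case (Suc n)
  have "2 * lucas_U X n \<le> (X - 1) * lucas_U X n"
    using Suc assms by (intro mult_right_mono) auto
  then have le: "2 * lucas_U X n \<le> lucas_U X (Suc n)" using Suc by linarith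
  then have "lucas_U X n + 1 \<le> lucas_U X (Suc n)"
    using Suc by (cases n) auto
  then show ?case using Suc by (auto simp: algebra_simps)
qed auto

text \<open>The prime r divides one of the two factors of U_r; \<open>prime_dvd_half_imp_dvd\<close>
  for X or for -X then gives r dividing X - 2 or X + 2.\<close>

lemma lucas_U_prime_dvd_self:
  assumes "prime r" "odd r" "int r dvd lucas_U X r"
  shows "int r dvd X\<^sup>2 - 4"
proof -
  obtain k where k: "r = 2 * k + 1" using assms(2) by (auto elim: oddE)
  let ?u = "lucas_U X k" and ?v = "lucas_U X (Suc k)"
  have factors: "X\<^sup>2 - 4 = (X - 2) * (X + 2)" by (simp add: algebra_simps power2_eq_square)
  have "int r dvd (?v + ?u) * (?v - ?u)"
    using assms(3) lucas_U_odd_index[of X k] k by simp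
  then have "int r dvd ?v + ?u \<or> int r dvd ?v - ?u"
    using assms(1) by (simp add: prime_dvd_mult_iff)
  then show ?thesis
  proof
    assume "int r dvd ?v + ?u"
    then have "int r dvd X - 2" by (rule prime_dvd_half_imp_dvd[OF assms(1) k])
    then show ?thesis unfolding factors by (rule dvd_mult2)
  next
    assume "int r dvd ?v - ?u"
    then have "int r dvd lucas_U (- X) (Suc k) + lucas_U (- X) k"
      by (auto simp: lucas_U_uminus dvd_diff_commute)
    then have "int r dvd - X - 2" by (rule prime_dvd_half_imp_dvd[OF assms(1) k])
    then have "int r dvd - (X + 2)" by (simp add: algebra_simps)
    then have "int r dvd X + 2" by (simp only: dvd_minus_iff)
    then show ?thesis unfolding factors by (rule dvd_mult)
  qed
qed

text \<open>Each of the two factors of U_r supplies one prime. The bound on X makes the smaller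
  factor U_(k+1) - U_k at least 3 k, hence larger than r; for X = 3 and r = 5 it is 8 - 3 = 5 = r,
  and the conclusion fails.\<close>

lemma lucas_U_two_primes:
  assumes "prime r" "r \<ge> 5" "X \<ge> 5"
  shows "\<exists>s t. prime s \<and> prime t \<and> s \<noteq> t \<and> s dvd lucas_U X r \<and> t dvd lucas_U X r
    \<and> s \<noteq> int r \<and> t \<noteq> int r \<and> \<not> s dvd X\<^sup>2 - 4 \<and> \<not> t dvd X\<^sup>2 - 4"
proof -
  have "odd r" using assms prime_odd_nat[of r] by auto
  then obtain k where k: "r = 2 * k + 1" by (auto elim: oddE)
  let ?u = "lucas_U X k" and ?v = "lucas_U X (Suc k)"
  have "4 * ?u \<le> (X - 1) * ?u"
    using lucas_U_growth[of X k] assms by (intro mult_right_mono) auto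
  then have gr: "4 * ?u \<le> ?v" "int k \<le> ?u"
    using lucas_U_growth[of X k] assms by auto
  have "\<bar>?v + ?u\<bar> > int r" using gr k assms by linarith
  from half_prime_divisor[OF assms(1) k assms(2) this]
  obtain s where s: "prime s" "s dvd ?v + ?u" "s \<noteq> int r" "\<not> s dvd X\<^sup>2 - 4" by blast
  have neg: "lucas_U (- X) (Suc k) + lucas_U (- X) k = (if even k then ?v - ?u else - (?v - ?u))"
    by (simp add: lucas_U_uminus)
  have "\<bar>lucas_U (- X) (Suc k) + lucas_U (- X) k\<bar> > int r"
    unfolding neg using gr k assms by simp
  from half_prime_divisor[OF assms(1) k assms(2) this]
  obtain t where t: "prime t" "t dvd ?v - ?u" "t \<noteq> int r" "\<not> t dvd X\<^sup>2 - 4"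
    unfolding neg by (auto split: if_splits simp: dvd_diff_commute)
  have dvd: "s dvd lucas_U X r" "t dvd lucas_U X r"
    unfolding k lucas_U_odd_index using s(2) t(2) by auto
  \<comment> \<open>The factors have sum 2 U_(k+1) and difference 2 U_k, so a common odd prime would
    divide two consecutive, hence coprime, terms. The prime 2 is excluded because U_r is odd when r
    is prime to 6.\<close>
  have "s \<noteq> t"
  proof
    assume "s = t"
    have "\<not> 2 dvd lucas_U X r"
    proof
      assume "2 dvd lucas_U X r"
      then have "3 dvd r" using even_lucas_U_iff[of X r] \<open>odd r\<close> by (auto split: if_splits)
      then show False using assms primes_dvd_imp_eq[of 3 r] by auto
    qed
    then have "s \<noteq> 2" using dvd by auto
    have "2 * ?v = (?v + ?u) + (?v - ?u)" "2 * ?u = (?v + ?u) - (?v - ?u)" by simp_all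
    then have "s dvd 2 * ?v" "s dvd 2 * ?u"
      using s(2) t(2) \<open>s = t\<close> by (metis dvd_add, metis dvd_diff)
    moreover have "\<not> s dvd 2" using s(1) \<open>s \<noteq> 2\<close> primes_dvd_imp_eq[of s 2] by auto
    ultimately have "s dvd ?v" "s dvd ?u" using s(1) by (auto simp: prime_dvd_mult_iff)
    then have "s dvd ?v\<^sup>2 - X * ?v * ?u + ?u\<^sup>2" by (simp add: power2_eq_square)
    then show False using s(1) lucas_U_norm[of X k] not_prime_unit by metis
  qed
  then show ?thesis using s t dvd by blast
qed

section \<open>Composite indices\<close>

text \<open>For q = 2 any prime of U_2 = X works, for q = 3 the prime 2 does. For q at least 5 only
  the larger factor is used, and it exceeds q already for X = 3.\<close>

lemma lucas_U_prime_index_prime: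
  assumes "prime q" "X \<ge> 3" "odd X"
  shows "\<exists>u. prime u \<and> u dvd lucas_U X q \<and> \<not> u dvd X\<^sup>2 - 4"
proof -
  consider "q = 2" | "q = 3" | "q \<ge> 5"
  proof -
    have "q \<noteq> 4" using assms(1) prime_odd_nat[of 4] by auto
    then show ?thesis using that prime_ge_2_nat[OF assms(1)] by linarith
  qed
  then show ?thesis
  proof cases
    case 1
    have "\<not> is_unit X" "X \<noteq> 0" using assms by auto
    then obtain u where u: "prime u" "u dvd X" using prime_divisor_exists by blast
    have "\<not> u dvd X\<^sup>2 - 4"
    proof
      assume "u dvd X\<^sup>2 - 4"
      moreover have "u dvd X\<^sup>2" using u by (simp add: power2_eq_square)
      ultimately have "u dvd X\<^sup>2 - (X\<^sup>2 - 4)" using dvd_diff by blast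
      then have "u dvd 2\<^sup>2" by simp
      then have "u dvd 2" using u(1) prime_dvd_power by blast
      then have "u = 2" using u(1) primes_dvd_imp_eq[of u 2] by auto
      then show False using u assms by auto
    qed
    then show ?thesis using u 1 by (auto simp: numeral_2_eq_2)
  next
    case 2
    have "even (lucas_U X 3)" by (simp add: even_lucas_U_iff assms)
    moreover have "odd (X\<^sup>2 - 4)" using assms by simp
    ultimately show ?thesis using 2 by (intro exI[of _ 2]) auto
  next
    case 3
    have "odd q" using assms(1) 3 prime_odd_nat[of q] by auto
    then obtain k where k: "q = 2 * k + 1" by (auto elim: oddE)
    have "2 * lucas_U X k \<le> (X - 1) * lucas_U X k"
      using lucas_U_growth[of X k] assms by (intro mult_right_mono) auto
    then have "\<bar>lucas_U X (Suc k) + lucas_U X k\<bar> > int q"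
      using lucas_U_growth[of X k] assms k 3 by linarith
    from half_prime_divisor[OF assms(1) k 3 this] show ?thesis
      unfolding k lucas_U_odd_index by auto
  qed
qed

text \<open>Needed for V_q to be at least 5 when q is at least 2, so that
  \<open>lucas_U_two_primes\<close> applies with parameter V_q, and for V_3 to be at least 7.
  Monotonicity is carried along to make the induction work.\<close>

lemma lucas_V_growth:
  assumes "X \<ge> 3"
  shows "2 * int n + 3 \<le> lucas_V X (Suc n) \<and> lucas_V X n < lucas_V X (Suc n)"
proof (induction n)
  case (Suc n)
  have IH: "2 * int n + 3 \<le> lucas_V X (Suc n)" "lucas_V X n < lucas_V X (Suc n)"
    using Suc by simp_all
  define w where "w = X * lucas_V X (Suc n)"
  have "3 * lucas_V X (Suc n) \<le> w"
    unfolding w_def using IH(1) assms by (intro mult_right_mono) auto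
  with IH have "2 * int (Suc n) + 3 \<le> w - lucas_V X n" "lucas_V X (Suc n) < w - lucas_V X n"
    by simp_all
  then show ?case unfolding w_def by simp
qed (use assms in auto)

text \<open>Since U_m divides U_n when m divides n, it suffices to find the primes in U_8, in U_9,
  in U_3 and U_4 together, or in U_(qr). The primes s of X and t of X^2 - 2 are fixed first; both
  divide U_4 and serve the cases 8 and 12.\<close>

lemma lucas_U_three_primes:
  assumes "X \<ge> 3" "odd X"
    and "8 dvd n \<or> 9 dvd n \<or> 12 dvd n \<or> (\<exists>q r. prime q \<and> prime r \<and> r \<ge> 5 \<and> q * r dvd n)"
  shows "\<exists>s t u. prime s \<and> prime t \<and> prime u \<and> s \<noteq> t \<and> s \<noteq> u \<and> t \<noteq> u
    \<and> s dvd lucas_U X n \<and> t dvd lucas_U X n \<and> u dvd lucas_U X n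
    \<and> \<not> s dvd X\<^sup>2 - 4 \<and> \<not> t dvd X\<^sup>2 - 4 \<and> \<not> u dvd X\<^sup>2 - 4"
proof -
  have odd_prime: "\<not> p dvd 2" if "prime p" "p dvd a" "odd a" for p a :: int
    using that primes_dvd_imp_eq[of p 2] by auto
  have four: "\<not> p dvd 4" if "prime p" "\<not> p dvd 2" for p :: int
    using that prime_dvd_mult_iff[of p 2 2] by auto
  obtain s where s: "prime s" "s dvd X"
    using prime_divisor_exists[of X] assms by auto
  have s2: "\<not> s dvd 2" using odd_prime[OF s assms(2)] .
  have sX: "\<not> s dvd X\<^sup>2 - 4"
  proof
    assume "s dvd X\<^sup>2 - 4"
    moreover have "s dvd X\<^sup>2" using s by (simp add: power2_eq_square)
    ultimately have "s dvd X\<^sup>2 - (X\<^sup>2 - 4)" using dvd_diff by blast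
    then show False using four s s2 by simp
  qed
  have "9 \<le> X * X" using mult_mono[of 3 X 3 X] assms by simp
  then have "\<not> is_unit (X\<^sup>2 - 2)" "X\<^sup>2 - 2 \<noteq> 0" by (auto simp: power2_eq_square)
  then obtain t where t: "prime t" "t dvd X\<^sup>2 - 2" using prime_divisor_exists by blast
  have t2: "\<not> t dvd 2" using odd_prime[OF t] assms by simp
  have tX: "\<not> t dvd X\<^sup>2 - 4"
  proof
    assume "t dvd X\<^sup>2 - 4"
    with t have "t dvd (X\<^sup>2 - 2) - (X\<^sup>2 - 4)" using dvd_diff by blast
    then show False using t2 by simp
  qed
  have st: "s \<noteq> t"
  proof
    assume "s = t"
    moreover have "s dvd X\<^sup>2" using s by (simp add: power2_eq_square)
    ultimately have "s dvd X\<^sup>2 - (X\<^sup>2 - 2)" using t dvd_diff by blast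
    then show False using s2 by simp
  qed
  have lift: "p dvd lucas_U X n" if "p dvd lucas_U X m" "m dvd n" for p m
    using that(1) lucas_U_dvd[OF that(2)] by (rule dvd_trans)
  have two: "\<not> 2 dvd X\<^sup>2 - 4" using assms by simp
  have U4: "lucas_U X 4 = X * (X\<^sup>2 - 2)"
    by (simp add: eval_nat_numeral algebra_simps)
  consider "8 dvd n" | "9 dvd n" | "12 dvd n"
    | q r where "prime q" "prime r" "r \<ge> 5" "q * r dvd n"
    using assms(3) by blast
  then show ?thesis
  proof cases
    case 1
    have "lucas_V X 4 = (X\<^sup>2 - 2)\<^sup>2 - 2"
      by (simp add: eval_nat_numeral algebra_simps)
    moreover have "lucas_U X (4 * 2) = lucas_U X 4 * lucas_V X 4"
      unfolding lucas_U_mult by (simp add: numeral_2_eq_2)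
    ultimately have U8: "lucas_U X 8 = X * (X\<^sup>2 - 2) * ((X\<^sup>2 - 2)\<^sup>2 - 2)" using U4 by simp
    have "49 \<le> (X\<^sup>2 - 2) * (X\<^sup>2 - 2)"
      using mult_mono[of 7 "X\<^sup>2 - 2" 7 "X\<^sup>2 - 2"] \<open>9 \<le> X * X\<close> by (simp add: power2_eq_square)
    then have "\<not> is_unit ((X\<^sup>2 - 2)\<^sup>2 - 2)" "(X\<^sup>2 - 2)\<^sup>2 - 2 \<noteq> 0"
      by (auto simp: power2_eq_square)
    then obtain u where u: "prime u" "u dvd (X\<^sup>2 - 2)\<^sup>2 - 2" using prime_divisor_exists by blast
    have u2: "\<not> u dvd 2" using odd_prime[OF u] assms by simp
    \<comment> \<open>The third factor (X^2 - 2)^2 - 2 of U_8 equals X^2 (X^2 - 4) + 2, so an odd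
      prime dividing it divides neither X nor the discriminant.\<close>
    have "\<not> u dvd X\<^sup>2 * (X\<^sup>2 - 4)"
    proof
      assume "u dvd X\<^sup>2 * (X\<^sup>2 - 4)"
      with u have "u dvd ((X\<^sup>2 - 2)\<^sup>2 - 2) - X\<^sup>2 * (X\<^sup>2 - 4)" using dvd_diff by blast
      then show False using u2 by (simp add: algebra_simps power2_eq_square)
    qed
    then have uX: "\<not> u dvd X" "\<not> u dvd X\<^sup>2 - 4" by (auto simp: power2_eq_square)
    have "t \<noteq> u"
    proof
      assume "t = u"
      moreover have "t dvd (X\<^sup>2 - 2)\<^sup>2"
        using t(2) unfolding power2_eq_square[of "X\<^sup>2 - 2"] by (rule dvd_mult)
      ultimately have "t dvd (X\<^sup>2 - 2)\<^sup>2 - ((X\<^sup>2 - 2)\<^sup>2 - 2)"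
        using u(2) dvd_diff by blast
      then show False using t2 by simp
    qed
    moreover have "s \<noteq> u" using s uX by auto
    moreover have "s dvd lucas_U X 8" "t dvd lucas_U X 8" "u dvd lucas_U X 8"
      unfolding U8 using s(2) t(2) u(2) by (simp_all only: dvd_mult dvd_mult2)
    then have "s dvd lucas_U X n" "t dvd lucas_U X n" "u dvd lucas_U X n"
      using lift 1 by blast+
    ultimately show ?thesis using s t u st sX tX uX by blast
  next
    case 2
    define Y where "Y = lucas_V X 3"
    have Y: "Y = X ^ 3 - 3 * X" by (simp add: Y_def eval_nat_numeral algebra_simps)
    have Y7: "Y \<ge> 7" using lucas_V_growth[OF assms(1), of 2] by (simp add: Y_def numeral_3_eq_3 numeral_2_eq_2)
    have "even Y" unfolding Y using assms by simp
    have norm: "Y\<^sup>2 - 4 = (X\<^sup>2 - 4) * (lucas_U X 3)\<^sup>2"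
      unfolding Y_def by (rule lucas_V_square)
    have "lucas_U Y 3 = (Y - 1) * (Y + 1)" by (simp add: eval_nat_numeral algebra_simps)
    then have U9: "lucas_U X 9 = lucas_U X 3 * ((Y - 1) * (Y + 1))"
      using lucas_U_mult[of X 3 3] unfolding Y_def[symmetric] by simp
    \<comment> \<open>Modulo 9, Y = X^3 - 3 X depends only on X modulo 3 and is 0, -2 or 2. Hence Y
      - 1 and Y + 1 each have a prime divisor other than 3; the third prime for U_9 is 2, from
      U_3.\<close>
    have not9: "\<not> 3\<^sup>2 dvd Y - 1 \<and> \<not> 3\<^sup>2 dvd Y + 1"
    proof -
      define m e where "m = X div 3" and "e = X mod 3"
      have X: "X = 3 * m + e" by (simp add: m_def e_def)
      have "Y = 9 * (3 * m ^ 3 + 3 * m\<^sup>2 * e + m * e\<^sup>2 - m) + (e ^ 3 - 3 * e)"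
        unfolding Y X by (simp add: algebra_simps power2_eq_square power3_eq_cube)
      then obtain w where w: "Y = 9 * w + (e ^ 3 - 3 * e)" by blast
      have "e = 0 \<or> e = 1 \<or> e = 2" unfolding e_def by presburger
      then have "Y = 9 * w \<or> Y = 9 * w - 2 \<or> Y = 9 * w + 2"
        using w by (elim disjE) simp_all
      then show ?thesis by (simp; presburger)
    qed
    obtain a where a: "prime a" "a dvd Y - 1" "a \<noteq> 3"
      using prime_divisor_other[of 3 "Y - 1"] Y7 not9 by auto
    obtain b where b: "prime b" "b dvd Y + 1" "b \<noteq> 3"
      using prime_divisor_other[of 3 "Y + 1"] Y7 not9 by auto
    have a2: "\<not> a dvd 2" using odd_prime[OF a(1,2)] \<open>even Y\<close> by simp
    have b2: "\<not> b dvd 2" using odd_prime[OF b(1,2)] \<open>even Y\<close> by simp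
    have "a \<noteq> b"
    proof
      assume "a = b"
      with a b have "a dvd (Y + 1) - (Y - 1)" using dvd_diff by blast
      then show False using a2 by simp
    qed
    \<comment> \<open>The discriminant X^2 - 4 divides Y^2 - 4, which differs from (Y - 1)(Y + 1) by
      3.\<close>
    have not_disc: "\<not> p dvd X\<^sup>2 - 4" if p: "prime p" "p \<noteq> 3" "p dvd (Y - 1) * (Y + 1)" for p
    proof
      assume "p dvd X\<^sup>2 - 4"
      then have "p dvd Y\<^sup>2 - 4" unfolding norm by simp
      with p have "p dvd (Y - 1) * (Y + 1) - (Y\<^sup>2 - 4)" using dvd_diff by blast
      then have "p dvd 3" by (simp add: algebra_simps power2_eq_square)
      then show False using p primes_dvd_imp_eq[of p 3] by auto
    qed
    have "even (lucas_U X 3)" by (simp add: even_lucas_U_iff assms)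
    then have "a dvd lucas_U X 9" "b dvd lucas_U X 9" "2 dvd lucas_U X 9"
      unfolding U9 using a(2) b(2) by (simp_all only: dvd_mult dvd_mult2)
    then have "a dvd lucas_U X n" "b dvd lucas_U X n" "2 dvd lucas_U X n"
      using lift 2 by blast+
    moreover have "a \<noteq> 2" "b \<noteq> 2" using a2 b2 by auto
    moreover have "\<not> a dvd X\<^sup>2 - 4" "\<not> b dvd X\<^sup>2 - 4" using not_disc a b by auto
    moreover have "prime (2::int)" by simp
    ultimately show ?thesis using a(1) b(1) \<open>a \<noteq> b\<close> two by blast
  next
    case 3
    have dvd: "3 dvd n" "4 dvd n" using 3 by presburger+
    have "even (lucas_U X 3)" by (simp add: even_lucas_U_iff assms)
    moreover have "s dvd lucas_U X 4" "t dvd lucas_U X 4"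
      unfolding U4 using s(2) t(2) by (simp_all only: dvd_mult dvd_mult2)
    ultimately have "s dvd lucas_U X n" "t dvd lucas_U X n" "2 dvd lucas_U X n"
      using lift dvd by blast+
    moreover have "s \<noteq> 2" "t \<noteq> 2" using s2 t2 by auto
    moreover have "prime (2::int)" by simp
    ultimately show ?thesis using s(1) t(1) st sX tX two by blast
  next
    case (4 q r)
    obtain u where u: "prime u" "u dvd lucas_U X q" "\<not> u dvd X\<^sup>2 - 4"
      using lucas_U_prime_index_prime[OF 4(1) assms(1,2)] by blast
    have "lucas_V X q \<ge> 5"
      using lucas_V_growth[OF assms(1), of "q - 1"] prime_ge_2_nat[OF 4(1)] by simp
    from lucas_U_two_primes[OF 4(2,3) this] obtain a b where
      ab: "prime a" "prime b" "a \<noteq> b"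
        "a dvd lucas_U (lucas_V X q) r" "b dvd lucas_U (lucas_V X q) r"
        "\<not> a dvd (lucas_V X q)\<^sup>2 - 4" "\<not> b dvd (lucas_V X q)\<^sup>2 - 4" by blast
    \<comment> \<open>Since V_q^2 - 4 = (X^2 - 4) U_q^2, the primes a and b avoid U_q as well as X^2
      - 4; avoiding U_q makes them different from u.\<close>
    have "\<not> a dvd X\<^sup>2 - 4" "\<not> b dvd X\<^sup>2 - 4" "\<not> a dvd lucas_U X q" "\<not> b dvd lucas_U X q"
      using ab(6,7) unfolding lucas_V_square by (auto simp: power2_eq_square)
    moreover have "a dvd lucas_U X (q * r)" "b dvd lucas_U X (q * r)" "u dvd lucas_U X (q * r)"
      unfolding lucas_U_mult using ab(4,5) u(2) by (simp_all only: dvd_mult dvd_mult2)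
    then have "a dvd lucas_U X n" "b dvd lucas_U X n" "u dvd lucas_U X n"
      using lift 4(4) by blast+
    ultimately show ?thesis using ab u by blast
  qed
qed

text \<open>If a prime r of size at least 5 divides n, a nonprime n has a further prime factor q,
  possibly r itself. Otherwise n = 2^a 3^b, and excluding multiples of 8, 9 and 12 leaves only 1, 2,
  3, 4 and 6.\<close>

lemma nonprime_index_cases:
  fixes n :: nat
  assumes "n > 0" "n \<notin> {1, 2, 3, 4, 6}" "\<not> prime n"
  shows "8 dvd n \<or> 9 dvd n \<or> 12 dvd n \<or> (\<exists>q r. prime q \<and> prime r \<and> r \<ge> 5 \<and> q * r dvd n)"
proof (cases "\<exists>r. prime r \<and> r \<ge> 5 \<and> r dvd n")
  case True
  then obtain r m where r: "prime r" "r \<ge> 5" "n = r * m" by blast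
  then have "m \<noteq> 1" using assms(3) by auto
  then obtain q where "prime q" "q dvd m" using prime_factor_nat by blast
  then have "q * r dvd n" using r by (simp add: mult.commute mult_dvd_mono)
  then show ?thesis using r \<open>prime q\<close> by blast
next
  case False
  have one: "l = 1" if "l dvd n" "\<not> 2 dvd l" "\<not> 3 dvd l" for l
  proof (rule ccontr)
    assume "l \<noteq> 1"
    then obtain p where p: "prime p" "p dvd l" using prime_factor_nat by blast
    then have "p < 5" using False that dvd_trans not_le by blast
    moreover have "p \<ge> 2" using p prime_ge_2_nat by blast
    moreover have "\<not> prime (4::nat)" using prime_odd_nat[of 4] by auto
    ultimately have "p = 2 \<or> p = 3"
      using p(1) by (cases "p = 4") auto
    then show False using p that by auto
  qed
  show ?thesis
  proof (rule ccontr)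
    assume no: "\<not> ?thesis"
    show False
    proof (cases "3 dvd n")
      case True
      then obtain m where m: "n = 3 * m" by blast
      have m3: "\<not> 3 dvd m" "\<not> 4 dvd m" using no m by auto
      show False
      proof (cases "2 dvd m")
        case True
        then obtain l where l: "m = 2 * l" by blast
        then have "l = 1" using m m3 by (intro one) auto
        then show False using l m assms(2) by simp
      next
        case False
        then have "m = 1" using m m3 by (intro one) auto
        then show False using m assms(2) by simp
      qed
    next
      case n3: False
      show False
      proof (cases "2 dvd n")
        case True
        then obtain m where m: "n = 2 * m" by blast
        show False
        proof (cases "2 dvd m")
          case True
          then obtain l where l: "m = 2 * l" by blast
          then have "l = 1" using m n3 no by (intro one) auto
          then show False using l m assms(2) by simp
        next
          case False
          then have "m = 1" using m n3 by (intro one) auto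
          then show False using m assms(2) by simp
        qed
      next
        case False
        then have "n = 1" using n3 by (intro one) auto
        then show False using assms(2) by simp
      qed
    qed
  qed
qed

section \<open>Solutions of the Pell equation\<close>

lemma pell4_parity:
  fixes D x y :: int
  assumes "odd D" "x\<^sup>2 - D * y\<^sup>2 = 4"
  shows "even x \<longleftrightarrow> even y"
proof -
  have "even (x\<^sup>2 - D * y\<^sup>2)" using assms(2) by simp
  then show ?thesis using assms(1) by auto
qed

lemma pell4_pos_solution_ge_3:
  assumes "D > 0" "pell4_pos_solution D x y"
  shows "x \<ge> 3"
proof (rule ccontr)
  assume "\<not> x \<ge> 3"
  then have "x\<^sup>2 \<le> 2\<^sup>2" using assms(2) by (intro power_mono) (auto simp: pell4_pos_solution_def)
  moreover have "D * y\<^sup>2 > 0" using assms by (simp add: pell4_pos_solution_def)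
  ultimately show False using assms(2) by (simp add: pell4_pos_solution_def)
qed

text \<open>On positive solutions x increases with y, so the least value of x + y sqrt D has the
  least y.\<close>

lemma pell4_minimal_le:
  assumes "D > 0" "pell4_minimal_solution D x\<^sub>1 y\<^sub>1" "pell4_pos_solution D x y"
  shows "y\<^sub>1 \<le> y"
proof (rule ccontr)
  assume "\<not> y\<^sub>1 \<le> y"
  then have lt: "y < y\<^sub>1" by simp
  have s1: "pell4_pos_solution D x\<^sub>1 y\<^sub>1" using assms(2) by (simp add: pell4_minimal_solution_def)
  have "y\<^sup>2 < y\<^sub>1\<^sup>2" using lt assms(3) by (intro power_strict_mono) (auto simp: pell4_pos_solution_def)
  then have "D * y\<^sup>2 < D * y\<^sub>1\<^sup>2" using assms(1) by simp
  then have "x\<^sup>2 < x\<^sub>1\<^sup>2" using s1 assms(3) by (auto simp: pell4_pos_solution_def)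
  then have "x < x\<^sub>1" using s1 by (auto simp: pell4_pos_solution_def intro: power_less_imp_less_base)
  moreover have "real_of_int y * sqrt D \<le> y\<^sub>1 * sqrt D"
    using lt assms(1) by (intro mult_right_mono) auto
  ultimately have "pell4_value D x y < pell4_value D x\<^sub>1 y\<^sub>1"
    unfolding pell4_value_def by linarith
  then show False using assms(2,3) by (force simp: pell4_minimal_solution_def)
qed

text \<open>Descent on y: dividing (x + y sqrt D) / 2 by (\<open>x\<^sub>1\<close> +
  \<open>y\<^sub>1\<close> sqrt D) / 2 gives a positive solution with smaller y, unless y is already
  \<open>y\<^sub>1\<close>. Multiplying back raises the Lucas index by one.\<close>

lemma pell4_solution_lucas:
  assumes "odd D" "D > 0" "pell4_minimal_solution D x\<^sub>1 y\<^sub>1" "pell4_pos_solution D x y"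
  shows "\<exists>n > 0. x = lucas_V x\<^sub>1 n \<and> y = y\<^sub>1 * lucas_U x\<^sub>1 n"
  using assms(4)
proof (induction "nat y" arbitrary: x y rule: less_induct)
  case less
  have min: "y\<^sub>1 \<le> y" using pell4_minimal_le[OF assms(2,3) less.prems] .
  have pos1: "x\<^sub>1 > 0" "y\<^sub>1 > 0" and eq1: "x\<^sub>1\<^sup>2 = 4 + D * y\<^sub>1\<^sup>2"
    using assms(3) by (auto simp: pell4_minimal_solution_def pell4_pos_solution_def)
  have pos: "x > 0" "y > 0" and eq: "x\<^sup>2 = 4 + D * y\<^sup>2"
    using less.prems by (auto simp: pell4_pos_solution_def)
  show ?case
  proof (cases "y = y\<^sub>1")
    case True
    then have "x\<^sup>2 = x\<^sub>1\<^sup>2" using eq eq1 by simp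
    then have "x = x\<^sub>1" using pos pos1 by (simp add: power2_eq_iff_nonneg)
    then show ?thesis using True by (intro exI[of _ 1]) auto
  next
    case False
    then have gt: "y\<^sub>1 < y" using min by simp
    have par: "even x = even y" "even x\<^sub>1 = even y\<^sub>1"
      using pell4_parity[OF assms(1)] eq eq1 by auto
    then have "even (x * x\<^sub>1 - D * y * y\<^sub>1)" "even (x\<^sub>1 * y - x * y\<^sub>1)"
      using assms(1) by auto
    \<comment> \<open>The quotient is computed by multiplying with the conjugate of the minimal
      solution; odd D and the parity of solutions make the halves integral.\<close>
    then obtain x' y' where x': "x * x\<^sub>1 - D * y * y\<^sub>1 = 2 * x'" and y': "x\<^sub>1 * y - x * y\<^sub>1 = 2 * y'"
      by (meson evenE)
    have sq: "y\<^sub>1\<^sup>2 < y\<^sup>2" using gt pos1 by (intro power_strict_mono) auto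
    have "(x\<^sub>1 * y)\<^sup>2 = (x * y\<^sub>1)\<^sup>2 + 4 * (y\<^sup>2 - y\<^sub>1\<^sup>2)"
      unfolding power_mult_distrib eq eq1 by (simp add: algebra_simps)
    then have "(x * y\<^sub>1)\<^sup>2 < (x\<^sub>1 * y)\<^sup>2" using sq by simp
    then have "x * y\<^sub>1 < x\<^sub>1 * y"
      using pos pos1 by (auto intro: power_less_imp_less_base)
    then have "y' > 0" using y' by simp
    have "(D * y * y\<^sub>1)\<^sup>2 = (D * y\<^sup>2) * (D * y\<^sub>1\<^sup>2)"
      by (simp add: algebra_simps power2_eq_square)
    also have "\<dots> < x\<^sup>2 * x\<^sub>1\<^sup>2"
      unfolding eq eq1 using assms(2) by (intro mult_strict_mono) (auto intro: add_pos_nonneg)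
    finally have "(D * y * y\<^sub>1)\<^sup>2 < (x * x\<^sub>1)\<^sup>2" by (simp add: power_mult_distrib)
    then have "D * y * y\<^sub>1 < x * x\<^sub>1"
      using pos pos1 by (auto intro: power_less_imp_less_base)
    then have "x' > 0" using x' by simp
    have "4 * (x'\<^sup>2 - D * y'\<^sup>2) = (2 * x')\<^sup>2 - D * (2 * y')\<^sup>2"
      by (simp add: power_mult_distrib algebra_simps)
    also have "\<dots> = (x\<^sup>2 - D * y\<^sup>2) * (x\<^sub>1\<^sup>2 - D * y\<^sub>1\<^sup>2)"
      unfolding x'[symmetric] y'[symmetric] by (simp add: algebra_simps power2_eq_square)
    finally have sol: "pell4_pos_solution D x' y'"
      using eq eq1 \<open>x' > 0\<close> \<open>y' > 0\<close> by (simp add: pell4_pos_solution_def)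
    have "x\<^sub>1 > 2"
      using pell4_pos_solution_ge_3[OF assms(2)] assms(3) by (force simp: pell4_minimal_solution_def)
    \<comment> \<open>The descent inequality y' < y is equivalent to (\<open>x\<^sub>1\<close> - 2)
      y < x \<open>y\<^sub>1\<close>, which is proved by comparing squares.\<close>
    have "((x\<^sub>1 - 2) * y)\<^sup>2 = (x\<^sub>1 - 2)\<^sup>2 * y\<^sup>2" by (simp add: power_mult_distrib)
    also have "\<dots> < ((x\<^sub>1 - 2) * (x\<^sub>1 + 2)) * y\<^sup>2"
      unfolding power2_eq_square[of "x\<^sub>1 - 2"] using \<open>x\<^sub>1 > 2\<close> pos
      by (intro mult_strict_right_mono mult_strict_left_mono) auto
    also have "(x\<^sub>1 - 2) * (x\<^sub>1 + 2) = D * y\<^sub>1\<^sup>2"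
      using eq1 by (simp add: algebra_simps power2_eq_square)
    also have "D * y\<^sub>1\<^sup>2 * y\<^sup>2 \<le> (4 + D * y\<^sup>2) * y\<^sub>1\<^sup>2"
      by (simp add: algebra_simps)
    also have "\<dots> = (x * y\<^sub>1)\<^sup>2"
      by (simp add: power_mult_distrib eq)
    finally have "(x\<^sub>1 - 2) * y < x * y\<^sub>1"
      using pos pos1 by (auto intro: power_less_imp_less_base)
    then have "y' < y" using y' by (simp add: algebra_simps)
    then have "nat y' < nat y" using pos by simp
    from less.hyps[OF this sol] obtain n where
      n: "x' = lucas_V x\<^sub>1 n" "y' = y\<^sub>1 * lucas_U x\<^sub>1 n" by blast
    \<comment> \<open>Multiplying the quotient back by the minimal solution expresses x and y
      through x' and y', hence through V_n and U_n.\<close>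
    have "2 * (x\<^sub>1 * x' + D * y\<^sub>1 * y') = x\<^sub>1 * (2 * x') + D * y\<^sub>1 * (2 * y')"
      by (simp add: algebra_simps)
    also have "\<dots> = x * (x\<^sub>1\<^sup>2 - D * y\<^sub>1\<^sup>2)"
      unfolding x'[symmetric] y'[symmetric] by (simp add: algebra_simps power2_eq_square)
    finally have "2 * (x\<^sub>1 * x' + D * y\<^sub>1 * y') = x * (x\<^sub>1\<^sup>2 - D * y\<^sub>1\<^sup>2)" .
    then have x: "x\<^sub>1 * x' + D * y\<^sub>1 * y' = 2 * x" using eq1 by simp
    have "2 * (x\<^sub>1 * y' + y\<^sub>1 * x') = x\<^sub>1 * (2 * y') + y\<^sub>1 * (2 * x')"
      by (simp add: algebra_simps)
    also have "\<dots> = y * (x\<^sub>1\<^sup>2 - D * y\<^sub>1\<^sup>2)"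
      unfolding x'[symmetric] y'[symmetric] by (simp add: algebra_simps power2_eq_square)
    finally have "2 * (x\<^sub>1 * y' + y\<^sub>1 * x') = y * (x\<^sub>1\<^sup>2 - D * y\<^sub>1\<^sup>2)" .
    then have y: "x\<^sub>1 * y' + y\<^sub>1 * x' = 2 * y" using eq1 by simp
    have disc: "D * y\<^sub>1\<^sup>2 = x\<^sub>1\<^sup>2 - 4" using eq1 by simp
    have "2 * y = y\<^sub>1 * (2 * lucas_U x\<^sub>1 (Suc n))"
      unfolding y[symmetric] n lucas_V_eq_U by (simp add: algebra_simps)
    moreover have "2 * x = x\<^sub>1 * lucas_V x\<^sub>1 n + (D * y\<^sub>1\<^sup>2) * lucas_U x\<^sub>1 n"
      unfolding x[symmetric] n by (simp add: algebra_simps power2_eq_square)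
    then have "2 * x = 2 * lucas_V x\<^sub>1 (Suc n)"
      unfolding disc lucas_V_eq_U by (simp add: algebra_simps power2_eq_square)
    ultimately show ?thesis by (intro exI[of _ "Suc n"]) auto
  qed
qed

lemma pell4_value_lucas:
  assumes "x\<^sub>1\<^sup>2 - D * y\<^sub>1\<^sup>2 = 4" "D \<ge> 0"
  shows "pell4_value D (lucas_V x\<^sub>1 n) (y\<^sub>1 * lucas_U x\<^sub>1 n) / 2 = (pell4_value D x\<^sub>1 y\<^sub>1 / 2) ^ n"
proof (induction n)
  case (Suc n)
  define P Y R v u v' u' where "P = real_of_int x\<^sub>1" and "Y = real_of_int y\<^sub>1"
    and "R = sqrt (real_of_int D)"
    and "v = real_of_int (lucas_V x\<^sub>1 n)" and "u = real_of_int (lucas_U x\<^sub>1 n)"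
    and "v' = real_of_int (lucas_V x\<^sub>1 (Suc n))" and "u' = real_of_int (lucas_U x\<^sub>1 (Suc n))"
  note defs = P_def Y_def R_def v_def u_def v'_def u'_def
  have v: "v = 2 * u' - P * u" unfolding defs lucas_V_eq_U by simp
  have v': "v' = P * u' - 2 * u" unfolding defs lucas_V_eq_U by simp
  have "real_of_int (x\<^sub>1\<^sup>2 - D * y\<^sub>1\<^sup>2) = real_of_int 4" using assms(1) by (rule arg_cong)
  then have "P\<^sup>2 - R\<^sup>2 * Y\<^sup>2 = 4"
    using assms(2) unfolding defs by simp
  then have disc: "R\<^sup>2 * Y\<^sup>2 = P\<^sup>2 - 4" by simp
  \<comment> \<open>This is one multiplication by \<epsilon>; replacing
    \<open>R\<^sup>2 * Y\<^sup>2\<close> by \<open>P\<^sup>2 - 4\<close> removes D, and the rest is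
    the Lucas recurrence.\<close>
  have "(P + Y * R) * (v + Y * u * R) = P * v + R\<^sup>2 * Y\<^sup>2 * u + Y * R * (v + P * u)"
    by (simp add: algebra_simps power2_eq_square)
  also have "\<dots> = 2 * (v' + Y * u' * R)"
    unfolding disc v v' by (simp add: algebra_simps power2_eq_square)
  finally have "(P + Y * R) / 2 * ((v + Y * u * R) / 2) = (v' + Y * u' * R) / 2"
    by simp
  then show ?case using Suc unfolding pell4_value_def defs by simp
qed (simp add: pell4_value_def)

text \<open>Every solution has its y divisible by \<open>y\<^sub>1\<close>, so one solution with odd
  y forces \<open>y\<^sub>1\<close> to be odd, and then \<open>x\<^sub>1\<close> by parity.\<close>

lemma pell4_minimal_odd:
  assumes "odd D" "D > 0" "pell4_minimal_solution D x\<^sub>1 y\<^sub>1"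
    and "\<exists>a b :: int. odd a \<and> odd b \<and> a\<^sup>2 - D * b\<^sup>2 = 4"
  shows "odd x\<^sub>1"
proof -
  obtain a b :: int where ab: "odd a" "odd b" "a\<^sup>2 - D * b\<^sup>2 = 4" using assms(4) by blast
  then have "a \<noteq> 0" "b \<noteq> 0" by auto
  then have "pell4_pos_solution D \<bar>a\<bar> \<bar>b\<bar>" using ab by (simp add: pell4_pos_solution_def)
  then obtain n where "\<bar>b\<bar> = y\<^sub>1 * lucas_U x\<^sub>1 n"
    using pell4_solution_lucas[OF assms(1-3)] by blast
  then have "odd y\<^sub>1" using ab by (metis dvd_abs_iff even_mult_iff)
  then show ?thesis
    using pell4_parity[OF assms(1)] assms(3)
    by (auto simp: pell4_minimal_solution_def pell4_pos_solution_def)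
qed

theorem theorem3p10:
  fixes D x\<^sub>1 y\<^sub>1 x y y' p\<^sub>1 p\<^sub>2 :: int and n\<^sub>1 n\<^sub>2 :: nat and \<epsilon> :: real
  assumes "odd D" and "D > 0" and "\<not> is_square D"
    and "\<exists>a b :: int. odd a \<and> odd b \<and> a\<^sup>2 - D * b\<^sup>2 = 4"
    and "pell4_minimal_solution D x\<^sub>1 y\<^sub>1"
    and "\<epsilon> = pell4_value D x\<^sub>1 y\<^sub>1"
    and "pell4_pos_solution D x y"
    and "y = p\<^sub>1 ^ n\<^sub>1 * p\<^sub>2 ^ n\<^sub>2 * y'"
    and "prime p\<^sub>1" and "prime p\<^sub>2" and "\<not> p\<^sub>1 dvd D" and "\<not> p\<^sub>2 dvd D"
    and "n\<^sub>1 > 0" and "n\<^sub>2 > 0" and "y' > 0"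
    and "\<forall>r :: int. prime r \<and> r dvd y' \<longrightarrow> r dvd D"
  shows "pell4_value D x y / 2 \<in> {\<epsilon> / 2, (\<epsilon> / 2) ^ 2, (\<epsilon> / 2) ^ 3, (\<epsilon> / 2) ^ 4, (\<epsilon> / 2) ^ 6} \<or>
    (\<exists>q :: nat. prime q \<and> odd q \<and> gcd (int q) (p\<^sub>1 * p\<^sub>2) = 1 \<and>
       pell4_value D x y / 2 = (\<epsilon> / 2) ^ q)"
proof -
  have pos1: "x\<^sub>1 > 0" "y\<^sub>1 > 0" and eq1: "x\<^sub>1\<^sup>2 - D * y\<^sub>1\<^sup>2 = 4"
    using assms(5) by (auto simp: pell4_minimal_solution_def pell4_pos_solution_def)
  obtain n where n: "n > 0" "x = lucas_V x\<^sub>1 n" "y = y\<^sub>1 * lucas_U x\<^sub>1 n"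
    using pell4_solution_lucas[OF assms(1,2,5,7)] by blast
  have val: "pell4_value D x y / 2 = (\<epsilon> / 2) ^ n"
    unfolding n(2,3) assms(6) using assms(2) by (intro pell4_value_lucas eq1) simp
  have disc: "x\<^sub>1\<^sup>2 - 4 = D * y\<^sub>1\<^sup>2" using eq1 by simp
  have odd1: "odd x\<^sub>1" by (rule pell4_minimal_odd[OF assms(1,2,5,4)])
  have ge3: "x\<^sub>1 \<ge> 3"
    using pell4_pos_solution_ge_3[OF assms(2)] assms(5) by (auto simp: pell4_minimal_solution_def)
  \<comment> \<open>A prime not dividing
    \<open>x\<^sub>1\<^sup>2 - 4 = D * y\<^sub>1\<^sup>2\<close> does not divide D, so it cannot
    come from y'. Thus U_n has at most two primes off the discriminant.\<close>
  have p12: "s = p\<^sub>1 \<or> s = p\<^sub>2"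
    if s: "prime s" "s dvd lucas_U x\<^sub>1 n" "\<not> s dvd x\<^sub>1\<^sup>2 - 4" for s
  proof -
    have "\<not> s dvd D" using s(3) unfolding disc by auto
    moreover have "s dvd p\<^sub>1 ^ n\<^sub>1 * p\<^sub>2 ^ n\<^sub>2 * y'" using s(2) n(3) assms(8) by auto
    ultimately have "s dvd p\<^sub>1 \<or> s dvd p\<^sub>2"
      using s(1) assms(16) by (auto simp: prime_dvd_mult_iff dest: prime_dvd_power)
    then show ?thesis using s(1) assms(9,10) primes_dvd_imp_eq by blast
  qed
  show ?thesis
  proof (cases "n \<in> {1, 2, 3, 4, 6}")
    case True
    then show ?thesis using val by auto
  next
    case small: False
    have "prime n"
    proof (rule ccontr)
      assume "\<not> prime n"
      from lucas_U_three_primes[OF ge3 odd1 nonprime_index_cases[OF n(1) small this]]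
      obtain s t u where "prime s" "prime t" "prime u" "s \<noteq> t" "s \<noteq> u" "t \<noteq> u"
        "s dvd lucas_U x\<^sub>1 n" "t dvd lucas_U x\<^sub>1 n" "u dvd lucas_U x\<^sub>1 n"
        "\<not> s dvd x\<^sub>1\<^sup>2 - 4" "\<not> t dvd x\<^sub>1\<^sup>2 - 4" "\<not> u dvd x\<^sub>1\<^sup>2 - 4" by blast
      then show False using p12[of s] p12[of t] p12[of u] by auto
    qed
    have "n \<ge> 5" using small n(1) by (cases "n < 5") (auto simp: less_Suc_eq numeral_eq_Suc)
    then have "odd n" using \<open>prime n\<close> prime_odd_nat[of n] by auto
    \<comment> \<open>If n itself were one of the two primes, then n would divide
      \<open>y\<^sub>1\<close>, making \<open>x\<^sub>1\<close> large enough for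
      \<open>lucas_U_two_primes\<close>. The two primes found there differ from n, so with n there
      would be three among \<open>p\<^sub>1\<close> and \<open>p\<^sub>2\<close>.\<close>
    have ndvd: "\<not> int n dvd p" if p: "prime p" "p = p\<^sub>1 \<or> p = p\<^sub>2" for p
    proof
      assume "int n dvd p"
      then have np: "int n = p" using \<open>prime n\<close> p(1) primes_dvd_imp_eq[of "int n" p] by simp
      have "int n dvd y" using np p(2) assms(8,13,14) by auto
      then have "int n dvd y\<^sub>1 \<or> int n dvd lucas_U x\<^sub>1 n"
        using n(3) \<open>prime n\<close> by (simp add: prime_dvd_mult_iff)
      moreover have "int n dvd y\<^sub>1" if "int n dvd lucas_U x\<^sub>1 n"
      proof -
        have "int n dvd D * y\<^sub>1\<^sup>2"
          using lucas_U_prime_dvd_self[OF \<open>prime n\<close> \<open>odd n\<close> that] unfolding disc .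
        moreover have "\<not> int n dvd D" using np p(2) assms(11,12) by auto
        ultimately show ?thesis
          using \<open>prime n\<close> by (auto simp: prime_dvd_mult_iff power2_eq_square)
      qed
      ultimately have "int n dvd y\<^sub>1" by blast
      then have "5 \<le> y\<^sub>1" using zdvd_imp_le[of "int n" y\<^sub>1] pos1 \<open>n \<ge> 5\<close> by simp
      \<comment> \<open>From \<open>y\<^sub>1\<close> at least 5 follows
        \<open>x\<^sub>1\<^sup>2 = 4 + D * y\<^sub>1\<^sup>2\<close>, which is at least 29 and so
        exceeds 25.\<close>
      have "x\<^sub>1 \<ge> 5"
      proof (rule ccontr)
        assume "\<not> x\<^sub>1 \<ge> 5"
        then have "x\<^sub>1\<^sup>2 \<le> 5\<^sup>2" using pos1 by (intro power_mono) auto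
        moreover have "5\<^sup>2 \<le> y\<^sub>1\<^sup>2" using \<open>5 \<le> y\<^sub>1\<close> by (intro power_mono) auto
        moreover have "1 * y\<^sub>1\<^sup>2 \<le> D * y\<^sub>1\<^sup>2" using assms(2) by (intro mult_right_mono) auto
        ultimately show False using disc by simp
      qed
      from lucas_U_two_primes[OF \<open>prime n\<close> \<open>n \<ge> 5\<close> this]
      obtain s t where "prime s" "prime t" "s \<noteq> t"
        "s dvd lucas_U x\<^sub>1 n" "t dvd lucas_U x\<^sub>1 n" "s \<noteq> int n" "t \<noteq> int n"
        "\<not> s dvd x\<^sub>1\<^sup>2 - 4" "\<not> t dvd x\<^sub>1\<^sup>2 - 4" by blast
      then show False using p12[of s] p12[of t] np p(2) by auto
    qed
    have "\<not> int n dvd p\<^sub>1 * p\<^sub>2"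
      using \<open>prime n\<close> ndvd[OF assms(9)] ndvd[OF assms(10)] by (simp add: prime_dvd_mult_iff)
    then have "coprime (int n) (p\<^sub>1 * p\<^sub>2)"
      using \<open>prime n\<close> by (intro prime_imp_coprime) auto
    then have "gcd (int n) (p\<^sub>1 * p\<^sub>2) = 1" by simp
    then show ?thesis using \<open>prime n\<close> \<open>odd n\<close> val by (intro disjI2 exI[of _ n] conjI)
  qed
qed

end
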